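(* Let $S$ be a closed oriented surface with an embedded weighted graph $(G,\Theta)$, where $G=\{V,E,F\}$ has vertex set $V$, edge set $E$ and face set $F$ and gives a polyhedral decomposition of $S$, and $\Theta:E\to(0,\frac{\pi}{2}]$ assigns weights to the edges. Let $\hat{\mathbf T}:F\to(0,\infty)$ lie in $\mathcal T$, let $\hat{\mathcal D}$ be the target circle pattern, i.e. the unique spherical ideal circle pattern underlying $(S,G,\Theta)$ whose total geodesic curvature vector is $\hat{\mathbf T}$, and let $\hat{\mathbf k}:F\to(0,\infty)$ be the geodesic curvature vector of $\hat{\mathcal D}$. Then for any initial ideal circle pattern $\mathcal D^0$ underlying $(S,G,\Theta)$, with geodesic curvature vector $\mathbf k^0$ and total geodesic curvature vector $\mathbf T^0\in\mathcal T$, the sequence of circle patterns $\{\mathcal D^m\}_{m\ge 1}$ constructed from $\mathcal D^0$ by Thurston's algorithm, with geodesic curvature vectors $\mathbf k^m$ and total geodesic curvature vectors $\mathbf T^m$, converges to $\hat{\mathcal D}$, with $$\lim_{m\to\infty}\mathbf k^m=\hat{\mathbf k}\quad\text{and}\quad \lim_{m\to\infty}\mathbf T^m=\hat{\mathbf T}.$$ Furthermore, if $\mathbf k^0$ satisfies $\mathbf T^0\le\hat{\mathbf T}$, then $\mathbf k^m(f)$ increases to $\hat{\mathbf k}(f)$ as $m\to\infty$ for every $f\in F$, and $\mathbf T^m\le\hat{\mathbf T}$ for every $m$; if $\mathbf k^0$ satisfies $\mathbf T^0\ge\hat{\mathbf T}$, then $\mathbf k^m(f)$ decreases to $\hat{\mathbf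 k}(f)$ as $m\to\infty$ for every $f\in F$, and $\mathbf T^m\ge\hat{\mathbf T}$ for every $m$.
   Context: **Conical disks.** For $\alpha>0$ and $r\in(0,\frac{\pi}{2})$, the conical spherical disk $D_\alpha(r)$ is the open metric disk of radius $r$ about a cone point of cone angle $\alpha$ in spherical (curvature $1$) geometry. Its boundary circle has geodesic curvature $k=\cot r\in(0,\infty)$, length $\ell=\alpha\sin r$, and total geodesic curvature $T=k\ell=\alpha\cos r$. All radii are restricted to $(0,\frac{\pi}{2})$. **Ideal circle patterns.** A spherical ideal circle pattern on a closed oriented surface $S$ with conical spherical metric is a finite collection $\mathcal D=\{D_1,\dots,D_p\}$ of conical spherical disks with a local isometry $\iota:\bigsqcup_i D_i\to S$ such that (1) $\iota(\bigsqcup_i D_i)$ is $S$ minus a finite set of points; (2) $\iota$ is at most two-to-one; (3) no $\iota(D_i)$ is contained in another $\iota(D_j)$. The pattern determines a weighted graph on $S$: the vertices are the omitted points, each face $f$ corresponds to a disk $D_f$, and each edge $e$ corresponds to a bigon $\Omega_e$ where disks overlap, weighted by the interior angle of the bigon. The pattern (together with its conical spherical metric on $S$) underlies $(S,G,\Theta)$ if this weighted graph is $(G,\Theta)$ up to isotopy. Polyhedral decomposition means that every face of $G$ is simply connected. **Parametrization by curvatures.** For every $\mathbf k:F\to(0,\infty)$ there is a unique (up to isometry) ideal spherical circle pattern $\mathcal D_{\mathbf k}$ underlying $(S,G,\Theta)$ such that the boundary circle of $D_f$ has geodesic curvature $\mathbf k(f)$ for each $f\in F$; it is obtained by gluing,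 along the combinatorics of $G$, the spherical quadrilaterals (one for each edge) formed by the centers and the two intersection points of two disks of radii $\operatorname{arccot}\mathbf k(f),\operatorname{arccot}\mathbf k(g)$ meeting in a bigon of angle $\Theta(e)$. Let $\mathbf T_{\mathbf k}:F\to(0,\infty)$ be the vector of total geodesic curvatures of the boundary circles of $\mathcal D_{\mathbf k}$. Explicitly, $\mathbf T_{\mathbf k}(f)$ is the sum, over the sides $e$ of the polygon $f$ (with $g$ the face on the other side of $e$), of $$\frac{2k_f}{\sqrt{1+k_f^2}}\operatorname{arccot}\left(\frac{1}{\sin\Theta(e)}\cdot\frac{k_g+k_f\cos\Theta(e)}{\sqrt{1+k_f^2}}\right),\qquad k_f=\mathbf k(f),\ k_g=\mathbf k(g),$$ with $\operatorname{arccot}$ valued in $(0,\pi)$. Since patterns underlying $(S,G,\Theta)$ are parametrized by their vectors $\mathbf k$, convergence of patterns means convergence of these vectors. **The set $\mathcal T$.** For $F'\subset F$ let $E(F')$ be the set of edges $e\in E$ that are an edge of some face in $F'$. Then $$\mathcal T=\Big\{\mathbf T:F\to(0,\infty)\ :\ \sum_{f\in F'}\mathbf T(f)<\sum_{e\in E(F')}2\Theta(e)\ \text{ for all nonempty } F'\subset F\Big\}.$$ For each $\hat{\mathbf T}\in\mathcal T$ there is a unique ideal spherical circle pattern $\hat{\mathcal D}=\mathcal D_{\hat{\mathbf k}}$ underlying $(S,G,\Theta)$ with $\mathbf T_{\hat{\mathbf k}}=\hat{\mathbf T}$ (a theorem of Nie). **Thurston's algorithm.** Write $F=\{f_1,\dots,f_{|F|}\}$.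 Given $\mathbf k^m$ (starting with $\mathbf k^0$), define $\mathbf k^{m+1}$ as follows: for each $i$, $\mathbf k^{m+1}(f_i)$ is the value $k_i'\in(0,\infty)$ such that, replacing $\mathbf k^m(f_i)$ by $k_i'$ and leaving $\mathbf k^m(f_j)$ unchanged for all $j\ne i$ (and the weights $\Theta$ unchanged), the total geodesic curvature of the boundary circle of the disk corresponding to $f_i$ becomes $\hat{\mathbf T}(f_i)$. Thus all coordinates of $\mathbf k^{m+1}$ are computed from the same $\mathbf k^m$. Set $\mathcal D^m=\mathcal D_{\mathbf k^m}$ and $\mathbf T^m=\mathbf T_{\mathbf k^m}$. Inequalities between functions on $F$ are pointwise; "increases" and "decreases" are meant in the weak (non-strict) sense. *)

theory Defs
  imports "HOL-Complex_Analysis.Complex_Analysis"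
begin

section \<open>Surfaces and embedded graphs\<close>

definition surface_chart :: "'a::t2_space set \<Rightarrow> 'a set \<Rightarrow> ('a \<Rightarrow> complex) \<Rightarrow> bool" where
  "surface_chart S U \<phi> \<longleftrightarrow>
     openin (top_of_set S) U \<and> open (\<phi> ` U) \<and> (\<exists>\<psi>. homeomorphism U (\<phi> ` U) \<phi> \<psi>)"

text \<open>A homeomorphism between open subsets of the plane preserves orientation iff the image of each
  small positively oriented circle winds once, positively, around the image of its centre.\<close>

definition oriented_atlas :: "'a::t2_space set \<Rightarrow> ('a set \<times> ('a \<Rightarrow> complex)) set \<Rightarrow> bool" where
  "oriented_atlas S \<A> \<longleftrightarrow>
     (\<forall>(U, \<phi>)\<in>\<A>. surface_chart S U \<phi>) \<and> \<Union> (fst ` \<A>) = S \<and>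
     (\<forall>(U, \<phi>)\<in>\<A>. \<forall>(W, \<psi>)\<in>\<A>. \<forall>z r. 0 < r \<longrightarrow> cball z r \<subseteq> \<phi> ` (U \<inter> W) \<longrightarrow>
        winding_number (\<psi> \<circ> inv_into U \<phi> \<circ> circlepath z r) (\<psi> (inv_into U \<phi> z)) = 1)"

definition closed_oriented_surface ::
    "'a::t2_space set \<Rightarrow> ('a set \<times> ('a \<Rightarrow> complex)) set \<Rightarrow> bool" where
  "closed_oriented_surface S \<A> \<longleftrightarrow> S \<noteq> {} \<and> compact S \<and> connected S \<and> oriented_atlas S \<A>"

text \<open>Edges are open arcs, without their end points; loops and multiple edges are allowed. The last
  clause says that edges are locally flat, i.e. look locally like a straight line in the plane.
  On a surface every embedded arc has this property, so no embedded graph is excluded.\<close>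

definition embedded_graph :: "'a::t2_space set \<Rightarrow> 'a set \<Rightarrow> 'a set set \<Rightarrow> bool" where
  "embedded_graph S V E \<longleftrightarrow>
     finite V \<and> V \<subseteq> S \<and> finite E \<and> disjoint E \<and>
     (\<forall>e\<in>E. e \<subseteq> S - V \<and>
        (\<exists>\<gamma>. path \<gamma> \<and> pathstart \<gamma> \<in> V \<and> pathfinish \<gamma> \<in> V \<and>
             inj_on \<gamma> {0<..<1} \<and> \<gamma> ` {0<..<1} = e) \<and>
        (\<forall>x\<in>e. \<exists>U \<phi>. x \<in> U \<and> surface_chart S U \<phi> \<and> U \<inter> (V \<union> \<Union>E) \<subseteq> e \<and>
             \<phi> ` U = ball 0 1 \<and> \<phi> ` (U \<inter> e) = {z \<in> ball 0 1. Im z = 0}))"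

definition faces :: "'a::t2_space set \<Rightarrow> 'a set \<Rightarrow> 'a set set \<Rightarrow> 'a set set" where
  "faces S V E = components (S - (V \<union> \<Union>E))"

definition polyhedral_decomposition :: "'a::t2_space set \<Rightarrow> 'a set \<Rightarrow> 'a set set \<Rightarrow> bool" where
  "polyhedral_decomposition S V E \<longleftrightarrow>
     embedded_graph S V E \<and> (\<forall>f\<in>faces S V E. simply_connected f)"

definition bordering_faces :: "'a::t2_space set \<Rightarrow> 'a set \<Rightarrow> 'a set set \<Rightarrow> 'a set \<Rightarrow> 'a set set" where
  "bordering_faces S V E e = {f \<in> faces S V E. e \<subseteq> closure f}"

definition edges_of :: "'a::t2_space set \<Rightarrow> 'a set \<Rightarrow> 'a set set \<Rightarrow> 'a set set \<Rightarrow> 'a set set" where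
  "edges_of S V E F' = {e \<in> E. \<exists>f\<in>F'. f \<in> bordering_faces S V E e}"

text \<open>The sum of \<open>h g e\<close> over the sides of the polygon \<open>f\<close>, where \<open>e\<close> is the edge that the side
  runs along and \<open>g\<close> the face on the other side of it. An edge has two sides in all. If it borders
  \<open>f\<close> and another face \<open>g\<close>, it is one side of \<open>f\<close>; if it borders \<open>f\<close> only, it occurs as two sides
  of \<open>f\<close>, and for both of them the face on the other side is \<open>f\<close> again.\<close>

definition sum_over_sides ::
    "'a::t2_space set \<Rightarrow> 'a set \<Rightarrow> 'a set set \<Rightarrow> 'a set \<Rightarrow> ('a set \<Rightarrow> 'a set \<Rightarrow> real) \<Rightarrow> real" where
  "sum_over_sides S V E f h =
     (\<Sum>e\<in>edges_of S V E {f}.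
        if bordering_faces S V E e = {f} then 2 * h f e
        else (\<Sum>g\<in>bordering_faces S V E e - {f}. h g e))"

section \<open>Conical spherical disks\<close>

record conical_disk =
  radius :: real
  cone_angle :: real

definition geodesic_curvature :: "conical_disk \<Rightarrow> real" where
  "geodesic_curvature D = cot (radius D)"

definition boundary_length :: "conical_disk \<Rightarrow> real" where
  "boundary_length D = cone_angle D * sin (radius D)"

definition total_geodesic_curvature :: "conical_disk \<Rightarrow> real" where
  "total_geodesic_curvature D = geodesic_curvature D * boundary_length D"

section \<open>The quadrilateral of two intersecting disks\<close>

definition spherical_dist :: "real^3 \<Rightarrow> real^3 \<Rightarrow> real" where
  "spherical_dist x y = arccos (x \<bullet> y)"

text \<open>The angle at the point \<open>c\<close> of the unit sphere between the great arcs to \<open>p\<close> and to \<open>q\<close>, measured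
  between their tangent directions.\<close>

definition spherical_angle :: "real^3 \<Rightarrow> real^3 \<Rightarrow> real^3 \<Rightarrow> real" where
  "spherical_angle p c q =
     (let u = p - (p \<bullet> c) *\<^sub>R c; v = q - (q \<bullet> c) *\<^sub>R c in arccos (u \<bullet> v / (norm u * norm v)))"

text \<open>The disks of radii \<open>a\<close> and \<open>b\<close> about \<open>c\<close> and \<open>d\<close> have boundary circles that intersect in \<open>p\<close> and \<open>q\<close>.
  The radii are perpendicular to the circles, so a bigon with interior angle \<open>\<theta>\<close> at \<open>p\<close> and \<open>q\<close> means
  that the radii meet there at angle \<open>pi - \<theta>\<close>.\<close>

definition disk_quadrilateral ::
    "real \<Rightarrow> real \<Rightarrow> real \<Rightarrow> real^3 \<Rightarrow> real^3 \<Rightarrow> real^3 \<Rightarrow> real^3 \<Rightarrow> bool" where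
  "disk_quadrilateral a b \<theta> c p d q \<longleftrightarrow>
     norm c = 1 \<and> norm p = 1 \<and> norm d = 1 \<and> norm q = 1 \<and> p \<noteq> q \<and>
     spherical_dist c p = a \<and> spherical_dist c q = a \<and>
     spherical_dist d p = b \<and> spherical_dist d q = b \<and>
     spherical_angle c p d = pi - \<theta> \<and> spherical_angle c q d = pi - \<theta>"

text \<open>The interior angle of the quadrilateral at the centre of the disk of radius \<open>a\<close>. The diagonal
  between the centres divides it into two.\<close>

definition central_angle :: "real \<Rightarrow> real \<Rightarrow> real \<Rightarrow> real" where
  "central_angle a b \<theta> =
     (THE \<omega>. \<exists>c p d q. disk_quadrilateral a b \<theta> c p d q \<and>
                       \<omega> = spherical_angle p c d + spherical_angle d c q)"

section \<open>Ideal circle patterns\<close>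

text \<open>A pattern underlying \<open>(S, G, \<Theta>)\<close> is a gluing, along the combinatorics of \<open>G\<close>, of one
  quadrilateral for each edge. It is given by its disks: around the centre of \<open>D f\<close> the
  quadrilaterals of the sides of \<open>f\<close> are arranged cyclically, and their angles add up to the cone
  angle. Only the values of \<open>D\<close> at faces matter.\<close>

definition ideal_circle_pattern ::
    "'a::t2_space set \<Rightarrow> 'a set \<Rightarrow> 'a set set \<Rightarrow> ('a set \<Rightarrow> real) \<Rightarrow> ('a set \<Rightarrow> conical_disk) \<Rightarrow> bool" where
  "ideal_circle_pattern S V E \<Theta> D \<longleftrightarrow>
     (\<forall>f\<in>faces S V E. 0 < radius (D f) \<and> radius (D f) < pi / 2 \<and> 0 < cone_angle (D f) \<and>
        cone_angle (D f) =
          sum_over_sides S V E f (\<lambda>g e. central_angle (radius (D f)) (radius (D g)) (\<Theta> e)))"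

definition curvatures :: "('f \<Rightarrow> conical_disk) \<Rightarrow> 'f \<Rightarrow> real" where
  "curvatures D f = geodesic_curvature (D f)"

definition total_curvatures :: "('f \<Rightarrow> conical_disk) \<Rightarrow> 'f \<Rightarrow> real" where
  "total_curvatures D f = total_geodesic_curvature (D f)"

definition arccot :: "real \<Rightarrow> real" where
  "arccot x = pi / 2 - arctan x"

definition pattern_of_curvatures ::
    "'a::t2_space set \<Rightarrow> 'a set \<Rightarrow> 'a set set \<Rightarrow> ('a set \<Rightarrow> real) \<Rightarrow> ('a set \<Rightarrow> real) \<Rightarrow> 'a set \<Rightarrow> conical_disk"
  where
  "pattern_of_curvatures S V E \<Theta> k f =
     \<lparr>radius = arccot (k f),
      cone_angle = sum_over_sides S V E f (\<lambda>g e. central_angle (arccot (k f)) (arccot (k g)) (\<Theta> e))\<rparr>"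

definition admissible_total_curvatures ::
    "'a::t2_space set \<Rightarrow> 'a set \<Rightarrow> 'a set set \<Rightarrow> ('a set \<Rightarrow> real) \<Rightarrow> ('a set \<Rightarrow> real) set" where
  "admissible_total_curvatures S V E \<Theta> =
     {T. (\<forall>f\<in>faces S V E. 0 < T f) \<and>
         (\<forall>F'. F' \<noteq> {} \<longrightarrow> F' \<subseteq> faces S V E \<longrightarrow>
            (\<Sum>f\<in>F'. T f) < (\<Sum>e\<in>edges_of S V E F'. 2 * \<Theta> e))}"

section \<open>Thurston's algorithm\<close>

definition thurston_step ::
    "'a::t2_space set \<Rightarrow> 'a set \<Rightarrow> 'a set set \<Rightarrow> ('a set \<Rightarrow> real) \<Rightarrow> ('a set \<Rightarrow> real) \<Rightarrow>
     ('a set \<Rightarrow> real) \<Rightarrow> 'a set \<Rightarrow> real" where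
  "thurston_step S V E \<Theta> T k f =
     (THE k'. 0 < k' \<and> total_curvatures (pattern_of_curvatures S V E \<Theta> (k(f := k'))) f = T f)"

primrec thurston_pattern ::
    "'a::t2_space set \<Rightarrow> 'a set \<Rightarrow> 'a set set \<Rightarrow> ('a set \<Rightarrow> real) \<Rightarrow> ('a set \<Rightarrow> real) \<Rightarrow>
     ('a set \<Rightarrow> conical_disk) \<Rightarrow> nat \<Rightarrow> 'a set \<Rightarrow> conical_disk" where
  "thurston_pattern S V E \<Theta> T D 0 = D"
| "thurston_pattern S V E \<Theta> T D (Suc m) =
     pattern_of_curvatures S V E \<Theta>
       (thurston_step S V E \<Theta> T (curvatures (thurston_pattern S V E \<Theta> T D m)))"

section \<open>The explicit formula for the total geodesic curvatures\<close>

lemma arccot_bounds: "0 < arccot x" "arccot x < pi"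
  using arctan_bounded[of x] by (auto simp: arccot_def)

lemma cos_arccot: "cos (arccot x) = x / sqrt (1 + x\<^sup>2)"
  by (simp add: arccot_def cos_diff sin_arctan)

lemma sin_arccot: "sin (arccot x) = 1 / sqrt (1 + x\<^sup>2)"
  by (simp add: arccot_def sin_diff cos_arctan)

lemma cot_arccot: "cot (arccot x) = x"
proof -
  have "sqrt (1 + x\<^sup>2) \<noteq> 0"
    using add_pos_nonneg[of 1 "x\<^sup>2"] by simp
  then show ?thesis
    by (simp add: cot_def cos_arccot sin_arccot)
qed

lemma arccot_less_pi_half: "0 < x \<Longrightarrow> arccot x < pi / 2"
  by (simp add: arccot_def)

lemma spherical_angle_eq:
  assumes "norm p = 1" "norm c = 1" "norm q = 1"
  shows "spherical_angle p c q =
    arccos ((p \<bullet> q - (p \<bullet> c) * (q \<bullet> c)) / (sqrt (1 - (p \<bullet> c)\<^sup>2) * sqrt (1 - (q \<bullet> c)\<^sup>2)))"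
proof -
  have cc: "c \<bullet> c = 1" "p \<bullet> p = 1" "q \<bullet> q = 1"
    using assms by (simp_all add: dot_square_norm)
  have n: "norm (x - (x \<bullet> c) *\<^sub>R c) = sqrt (1 - (x \<bullet> c)\<^sup>2)" if "x \<bullet> x = 1" for x
    using cc that
    by (simp add: norm_eq_sqrt_inner inner_diff_left inner_diff_right inner_commute power2_eq_square)
  show ?thesis
    unfolding spherical_angle_def Let_def n[OF cc(2)] n[OF cc(3)]
    using cc by (simp add: inner_diff_left inner_diff_right inner_commute mult.commute)
qed

lemma central_angle_aux:
  fixes a b \<theta> :: real
  defines "z \<equiv> cos a * cos b - sin a * sin b * cos \<theta>"
    and "N \<equiv> sin a * cos b + cos a * sin b * cos \<theta>" and "M \<equiv> sin b * sin \<theta>"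
  shows "1 - z\<^sup>2 = N\<^sup>2 + M\<^sup>2" and "cos b - cos a * z = sin a * N"
proof -
  have s: "(sin x)\<^sup>2 = 1 - (cos x)\<^sup>2" for x :: real
    by (rule sin_squared_eq)
  have M: "M\<^sup>2 = (1 - (cos b)\<^sup>2) * (1 - (cos \<theta>)\<^sup>2)"
    unfolding M_def by (simp add: power_mult_distrib s)
  have "z\<^sup>2 + N\<^sup>2 = ((cos a)\<^sup>2 + (sin a)\<^sup>2) * ((cos b)\<^sup>2 + (sin b)\<^sup>2 * (cos \<theta>)\<^sup>2)"
    unfolding z_def N_def by algebra
  then have "z\<^sup>2 + N\<^sup>2 = (cos b)\<^sup>2 + (1 - (cos b)\<^sup>2) * (cos \<theta>)\<^sup>2"
    by (simp add: s)
  with M show "1 - z\<^sup>2 = N\<^sup>2 + M\<^sup>2"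
    by (simp add: algebra_simps)
  have "cos b - cos a * z = (1 - (cos a)\<^sup>2) * cos b + cos a * sin a * sin b * cos \<theta>"
    unfolding z_def by (simp add: power2_eq_square algebra_simps)
  also have "\<dots> = (sin a)\<^sup>2 * cos b + cos a * sin a * sin b * cos \<theta>"
    by (simp add: s)
  finally show "cos b - cos a * z = sin a * N"
    unfolding N_def by (simp add: power2_eq_square algebra_simps)
qed

lemma disk_triangle_angle:
  assumes ab: "0 < a" "a < pi / 2" "0 < b" "b < pi / 2" "0 < \<theta>" "\<theta> < pi"
    and n: "norm c = 1" "norm p = 1" "norm d = 1"
    and cp: "c \<bullet> p = cos a" and dp: "d \<bullet> p = cos b"
  defines "t \<equiv> (sin a * cos b + cos a * sin b * cos \<theta>) / (sin b * sin \<theta>)"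
  shows "spherical_angle c p d = pi - \<theta> \<longleftrightarrow> c \<bullet> d = cos a * cos b - sin a * sin b * cos \<theta>"
    and "c \<bullet> d = cos a * cos b - sin a * sin b * cos \<theta> \<Longrightarrow> spherical_angle p c d = arccot t"
    and "spherical_angle p c d = spherical_angle d c p"
proof -
  define z where "z = cos a * cos b - sin a * sin b * cos \<theta>"
  define N where "N = sin a * cos b + cos a * sin b * cos \<theta>"
  define M where "M = sin b * sin \<theta>"
  have pos: "0 < sin a" "0 < sin b" "0 < sin \<theta>"
    using ab by (auto intro!: sin_gt_zero)
  have M: "0 < M" unfolding M_def using pos by simp
  note aux = central_angle_aux[where a=a and b=b and \<theta>=\<theta>, folded z_def N_def M_def]
  have sq: "sqrt (1 - (cos a)\<^sup>2) = sin a" "sqrt (1 - (cos b)\<^sup>2) = sin b"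
    using pos by (simp_all add: sin_squared_eq[symmetric] real_sqrt_abs)
  have ang: "spherical_angle c p d = arccos ((c \<bullet> d - cos a * cos b) / (sin a * sin b))"
    using n by (simp add: spherical_angle_eq cp dp sq)
  have cd1: "- 1 \<le> (c \<bullet> d - cos a * cos b) / (sin a * sin b) \<and>
             (c \<bullet> d - cos a * cos b) / (sin a * sin b) \<le> 1"
  proof -
    let ?u = "c - (c \<bullet> p) *\<^sub>R p" and ?v = "d - (d \<bullet> p) *\<^sub>R p"
    have 1: "c \<bullet> c = 1" "d \<bullet> d = 1" "p \<bullet> p = 1"
      using n by (simp_all add: dot_square_norm)
    have nu: "norm ?u = sin a" "norm ?v = sin b"
      using 1 cp dp sq
      by (simp_all add: norm_eq_sqrt_inner inner_diff_left inner_diff_right inner_commute power2_eq_square)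
    have uv: "?u \<bullet> ?v = c \<bullet> d - cos a * cos b"
      using 1 cp dp by (simp add: inner_diff_left inner_diff_right inner_commute mult.commute)
    have "\<bar>c \<bullet> d - cos a * cos b\<bar> \<le> sin a * sin b"
      using Cauchy_Schwarz_ineq2[of ?u ?v] unfolding nu uv .
    then show ?thesis using pos by (auto simp: field_simps abs_le_iff)
  qed
  show "spherical_angle c p d = pi - \<theta> \<longleftrightarrow> c \<bullet> d = cos a * cos b - sin a * sin b * cos \<theta>"
  proof
    assume "spherical_angle c p d = pi - \<theta>"
    then have "cos (arccos ((c \<bullet> d - cos a * cos b) / (sin a * sin b))) = cos (pi - \<theta>)"
      by (simp add: ang)
    then have "(c \<bullet> d - cos a * cos b) / (sin a * sin b) = - cos \<theta>"
      using cd1 by (simp add: cos_arccos)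
    then show "c \<bullet> d = cos a * cos b - sin a * sin b * cos \<theta>"
      using pos by (simp add: field_simps)
  next
    assume "c \<bullet> d = cos a * cos b - sin a * sin b * cos \<theta>"
    then have "(c \<bullet> d - cos a * cos b) / (sin a * sin b) = cos (pi - \<theta>)"
      using pos by (simp add: field_simps)
    then show "spherical_angle c p d = pi - \<theta>"
      using ab by (simp add: ang arccos_cos del: cos_pi_minus)
  qed
  show "spherical_angle p c d = spherical_angle d c p"
    by (simp add: spherical_angle_def Let_def inner_commute mult.commute)
  assume cd: "c \<bullet> d = cos a * cos b - sin a * sin b * cos \<theta>"
  have "spherical_angle p c d =
      arccos ((cos b - cos a * z) / (sin a * sqrt (N\<^sup>2 + M\<^sup>2)))"
    using n cp dp cd
    by (simp add: spherical_angle_eq inner_commute z_def[symmetric] sq aux(1))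
  also have "\<dots> = arccos (N / sqrt (N\<^sup>2 + M\<^sup>2))"
    using pos by (simp add: aux(2))
  also have "N / sqrt (N\<^sup>2 + M\<^sup>2) = cos (arccot t)"
  proof -
    have t: "t = N / M" by (simp add: t_def N_def M_def)
    have "sqrt (1 + t\<^sup>2) = sqrt ((N\<^sup>2 + M\<^sup>2) / M\<^sup>2)"
      using M by (simp add: t power_divide add_divide_distrib add.commute)
    also have "\<dots> = sqrt (N\<^sup>2 + M\<^sup>2) / M"
      using M by (simp add: real_sqrt_divide)
    finally show ?thesis
      using M by (simp add: cos_arccot t)
  qed
  also have "arccos (cos (arccot t)) = arccot t"
    using arccot_bounds[of t] by (intro arccos_cos) auto
  finally show "spherical_angle p c d = arccot t" .
qed

lemma spherical_dist_eq_iff: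
  assumes "norm x = 1" "norm y = 1" "0 < a" "a < pi / 2"
  shows "spherical_dist x y = a \<longleftrightarrow> x \<bullet> y = cos a"
proof -
  have "\<bar>x \<bullet> y\<bar> \<le> 1"
    using Cauchy_Schwarz_ineq2[of x y] assms by simp
  then show ?thesis
    using assms unfolding spherical_dist_def
    by (metis abs_le_iff arccos_cos cos_arccos_abs less_eq_real_def linorder_not_less
        minus_le_iff order.strict_trans pi_half_less_two pi_half_gt_zero pi_gt_zero
        add_strict_mono field_sum_of_halves less_add_same_cancel1)
qed

lemma disk_quadrilateral_exists:
  assumes ab: "0 < a" "a < pi / 2" "0 < b" "b < pi / 2" "0 < \<theta>" "\<theta> < pi"
  shows "\<exists>c p d q. disk_quadrilateral a b \<theta> c p d q"
proof -
  define z where "z = cos a * cos b - sin a * sin b * cos \<theta>"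
  define N where "N = sin a * cos b + cos a * sin b * cos \<theta>"
  define M where "M = sin b * sin \<theta>"
  define w where "w = sqrt (N\<^sup>2 + M\<^sup>2)"
  have pos: "0 < sin a" "0 < sin b" "0 < sin \<theta>"
    using ab by (auto intro!: sin_gt_zero)
  have M: "0 < M" unfolding M_def using pos by simp
  note aux = central_angle_aux[where a=a and b=b and \<theta>=\<theta>, folded z_def N_def M_def]
  have w: "0 < w" unfolding w_def using M by (simp add: add_nonneg_pos)
  have w2: "w * w = N\<^sup>2 + M\<^sup>2" unfolding w_def by simp
  define c :: "real^3" where "c = vector [1, 0, 0]"
  define d :: "real^3" where "d = vector [z, w, 0]"
  define p :: "real^3" where "p = vector [cos a, sin a * N / w, sin a * M / w]"
  define q :: "real^3" where "q = vector [cos a, sin a * N / w, - (sin a * M / w)]"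
  note df = c_def d_def p_def q_def inner_vec_def sum_3
  have "(sin a * N / w)\<^sup>2 + (sin a * M / w)\<^sup>2 = (sin a)\<^sup>2 * ((N\<^sup>2 + M\<^sup>2) / w\<^sup>2)"
    by (simp add: power_mult_distrib power_divide distrib_left add_divide_distrib)
  also have "\<dots> = (sin a)\<^sup>2"
    unfolding w2[symmetric] using w by (simp add: power2_eq_square)
  finally have e: "(sin a * N / w)\<^sup>2 + (sin a * M / w)\<^sup>2 = (sin a)\<^sup>2" .
  have n: "norm c = 1" "norm d = 1" "norm p = 1" "norm q = 1"
    using e aux(1) w2 sin_cos_squared_add[of a]
    by (simp_all add: norm_eq_1 df power2_eq_square)
  have cpq: "c \<bullet> p = cos a" "c \<bullet> q = cos a" "c \<bullet> d = z"
    by (simp_all add: df)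
  have dpq: "d \<bullet> p = cos b" "d \<bullet> q = cos b"
    using w aux(2) by (simp_all add: df algebra_simps)
  have "p $ 3 \<noteq> q $ 3" using pos M w by (simp add: p_def q_def)
  then have "p \<noteq> q" by metis
  moreover have "spherical_angle c p d = pi - \<theta>" "spherical_angle c q d = pi - \<theta>"
    using disk_triangle_angle(1)[OF ab n(1,3,2) cpq(1) dpq(1)]
      disk_triangle_angle(1)[OF ab n(1,4,2) cpq(2) dpq(2)] cpq(3)
    by (simp_all add: z_def)
  ultimately have "disk_quadrilateral a b \<theta> c p d q"
    unfolding disk_quadrilateral_def using n cpq dpq ab by (simp add: spherical_dist_eq_iff)
  then show ?thesis by blast
qed

lemma central_angle_eq:
  assumes ab: "0 < a" "a < pi / 2" "0 < b" "b < pi / 2" "0 < \<theta>" "\<theta> < pi"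
  shows "central_angle a b \<theta> =
    2 * arccot ((sin a * cos b + cos a * sin b * cos \<theta>) / (sin b * sin \<theta>))"
proof -
  let ?\<omega> = "2 * arccot ((sin a * cos b + cos a * sin b * cos \<theta>) / (sin b * sin \<theta>))"
  have *: "spherical_angle p c d + spherical_angle d c q = ?\<omega>"
    if "disk_quadrilateral a b \<theta> c p d q" for c p d q
  proof -
    have n: "norm c = 1" "norm p = 1" "norm d = 1" "norm q = 1"
      and i: "c \<bullet> p = cos a" "c \<bullet> q = cos a" "d \<bullet> p = cos b" "d \<bullet> q = cos b"
      and ang: "spherical_angle c p d = pi - \<theta>"
      using that spherical_dist_eq_iff[OF _ _ ab(1,2)] spherical_dist_eq_iff[OF _ _ ab(3,4)]
      unfolding disk_quadrilateral_def by blast+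
    note 1 = disk_triangle_angle[OF ab n(1,2,3) i(1,3)]
    note 2 = disk_triangle_angle[OF ab n(1,4,3) i(2,4)]
    have cd: "c \<bullet> d = cos a * cos b - sin a * sin b * cos \<theta>"
      using 1(1) ang by simp
    show ?thesis
      using 1(2)[OF cd] 2(2)[OF cd] 2(3) by simp
  qed
  obtain c p d q where "disk_quadrilateral a b \<theta> c p d q"
    using disk_quadrilateral_exists[OF ab] by blast
  then have "\<exists>c p d q. disk_quadrilateral a b \<theta> c p d q \<and>
      ?\<omega> = spherical_angle p c d + spherical_angle d c q"
    using *[of c p d q] by (intro exI[of _ c] exI[of _ p] exI[of _ d] exI[of _ q]) simp
  then show ?thesis
    unfolding central_angle_def by (rule the_equality) (elim exE conjE, simp only: *)
qed

lemma total_curvatures_pattern_of_curvatures: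
  assumes k: "\<And>g. g \<in> faces S V E \<Longrightarrow> 0 < k g"
    and \<Theta>: "\<And>e. e \<in> E \<Longrightarrow> 0 < \<Theta> e \<and> \<Theta> e \<le> pi / 2"
    and f: "f \<in> faces S V E"
  shows "total_curvatures (pattern_of_curvatures S V E \<Theta> k) f =
    sum_over_sides S V E f (\<lambda>g e. 2 * k f / sqrt (1 + (k f)\<^sup>2) *
      arccot (1 / sin (\<Theta> e) * ((k g + k f * cos (\<Theta> e)) / sqrt (1 + (k f)\<^sup>2))))"
proof -
  let ?s = "sqrt (1 + (k f)\<^sup>2)"
  have frac: "(1 / s * (y / t) + x / s * (1 / t) * c) / (1 / t * \<sigma>) = 1 / \<sigma> * ((y + x * c) / s)"
    if "0 < s" "0 < t" "0 < \<sigma>" for s t \<sigma> x y c :: real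
    using that by (simp add: field_simps)
  have side: "cos (arccot (k f)) * central_angle (arccot (k f)) (arccot (k g)) (\<Theta> e) =
      2 * k f / ?s * arccot (1 / sin (\<Theta> e) * ((k g + k f * cos (\<Theta> e)) / ?s))"
    if "g \<in> faces S V E" "e \<in> E" for g e
  proof -
    let ?t = "sqrt (1 + (k g)\<^sup>2)"
    have p: "0 < \<Theta> e" "\<Theta> e < pi" "0 < ?t" "0 < ?s"
      using \<Theta>[OF that(2)] pi_gt_zero by (auto simp: add_pos_nonneg)
    then have "0 < sin (\<Theta> e)" by (simp add: sin_gt_zero)
    note q = frac[OF p(4,3) this, of "k g" "k f" "cos (\<Theta> e)"]
    have "central_angle (arccot (k f)) (arccot (k g)) (\<Theta> e) =
        2 * arccot (1 / sin (\<Theta> e) * ((k g + k f * cos (\<Theta> e)) / ?s))"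
      using k[OF f] k[OF that(1)] p(1,2)
      by (simp only: central_angle_eq arccot_bounds arccot_less_pi_half cos_arccot sin_arccot q)
    then show ?thesis by (simp add: cos_arccot)
  qed
  have "total_curvatures (pattern_of_curvatures S V E \<Theta> k) f =
      cos (arccot (k f)) * sum_over_sides S V E f
        (\<lambda>g e. central_angle (arccot (k f)) (arccot (k g)) (\<Theta> e))"
    using arccot_bounds[of "k f"] sin_gt_zero[of "arccot (k f)"]
    by (simp add: total_curvatures_def pattern_of_curvatures_def total_geodesic_curvature_def
        geodesic_curvature_def boundary_length_def cot_def)
  also have "\<dots> = sum_over_sides S V E f
      (\<lambda>g e. cos (arccot (k f)) * central_angle (arccot (k f)) (arccot (k g)) (\<Theta> e))"
    by (simp add: sum_over_sides_def sum_distrib_left if_distrib mult.left_commute cong: if_cong)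
  also have "\<dots> = sum_over_sides S V E f (\<lambda>g e. 2 * k f / ?s *
      arccot (1 / sin (\<Theta> e) * ((k g + k f * cos (\<Theta> e)) / ?s)))"
    unfolding sum_over_sides_def
    by (intro sum.cong refl if_cong arg_cong[where f = "(*) 2"] side f)
       (auto simp: edges_of_def bordering_faces_def)
  finally show ?thesis .
qed

end

theory Submission
  imports Defs
begin

text \<open>
  Let a side of a face with curvature \<open>x\<close> separate it from a face with curvature \<open>y\<close>, the disks
  meeting at angle \<open>\<theta>\<close>. With \<open>u = x / sqrt (1 + x\<^sup>2)\<close> and \<open>C = (y / x + cos \<theta>) / sin \<theta>\<close>, the side
  contributes \<open>2 * u * arccot (u * C)\<close> to the total geodesic curvature. For fixed \<open>x\<close> this decreases
  in \<open>y\<close>. Multiplying both curvatures by the same \<open>t > 1\<close> keeps \<open>C\<close> and enlarges \<open>u\<close>; as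
  \<open>w * arccot w\<close> is strictly increasing in \<open>w\<close>, the contribution then strictly grows. Hence the
  total curvature \<open>T k f\<close> is antitone in the curvatures of the faces other than \<open>f\<close>
  (\<open>side_curvature_antimono\<close>) and strictly increasing under scaling of all curvatures
  (\<open>side_curvature_scale\<close>). Both properties survive summation over sides, also when a face is
  adjacent to itself.

  Convergence follows from these two properties and continuity. They give a comparison principle,
  \<open>T k \<le> T l\<close> implies \<open>k \<le> l\<close>: if the largest ratio \<open>t\<close> of \<open>k\<close> to \<open>l\<close> were above 1 and attained at
  \<open>f\<close>, then \<open>k\<close> would lie below \<open>t * l\<close> and agree with it at \<open>f\<close>, so that
  \<open>T l f < T (t * l) f \<le> T k f\<close>. In particular the target curvatures \<open>khat\<close> are determined by their
  total curvatures.

  The antitone dependence makes one step of the algorithm monotone in \<open>k\<close>, and it makes the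
  conditions \<open>T k \<le> T khat\<close> and \<open>T khat \<le> T k\<close> invariant under a step, with \<open>k\<close> increasing in the
  first case and decreasing in the second. By comparison the iterates stay on their side of \<open>khat\<close>,
  so they converge to a positive limit; by continuity the limit has the total curvatures of \<open>khat\<close>
  and is \<open>khat\<close>. An arbitrary start lies between \<open>khat / t\<close> and \<open>t * khat\<close> for large \<open>t\<close>. By the
  scaling property these two vectors satisfy the first and the second condition, and the runs that
  start from them squeeze the given run towards \<open>khat\<close>.
\<close>

section \<open>The contribution of one side\<close>

definition side_curvature :: "real \<Rightarrow> real \<Rightarrow> real \<Rightarrow> real" where
  "side_curvature x y \<theta> =
     2 * x / sqrt (1 + x\<^sup>2) * arccot (1 / sin \<theta> * ((y + x * cos \<theta>) / sqrt (1 + x\<^sup>2)))"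

lemma arccot_antimono: "x \<le> y \<Longrightarrow> arccot y \<le> arccot x"
  by (simp add: arccot_def arctan_le_iff)

text \<open>The derivative \<open>arccot z - z / (1 + z\<^sup>2)\<close> equals \<open>\<phi> - sin \<phi> * cos \<phi>\<close> for \<open>\<phi> = arccot z\<close>, which is
  positive for \<open>\<phi>\<close> in \<open>(0, pi / 2)\<close>.\<close>

lemma mult_arccot_strict_mono:
  fixes x y :: real
  assumes "0 < x" "x < y"
  shows "x * arccot x < y * arccot y"
proof (rule DERIV_pos_imp_increasing[OF assms(2)])
  fix z assume "x \<le> z" "z \<le> y"
  with assms have z: "0 < z" by simp
  have pos: "0 < 1 + z\<^sup>2" by (simp add: add_pos_nonneg)
  let ?\<phi> = "arccot z"
  have \<phi>: "0 < ?\<phi>" "?\<phi> < pi / 2"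
    using arccot_bounds z arccot_less_pi_half by auto
  have s: "0 < sin ?\<phi>" using \<phi> by (intro sin_gt_zero) auto
  have "cos ?\<phi> < cos 0" using \<phi> by (intro cos_monotone_0_pi) auto
  then have "sin ?\<phi> * cos ?\<phi> < sin ?\<phi>" using s by simp
  also have "sin ?\<phi> \<le> ?\<phi>" using \<phi> by (intro sin_x_le_x) auto
  finally have "sin ?\<phi> * cos ?\<phi> < ?\<phi>" .
  moreover have "sin ?\<phi> * cos ?\<phi> = z / (1 + z\<^sup>2)"
    using pos by (simp add: sin_arccot cos_arccot)
  ultimately have gt: "0 < arccot z - z / (1 + z\<^sup>2)" by simp
  have "((\<lambda>z. z * arccot z) has_real_derivative (arccot z - z / (1 + z\<^sup>2))) (at z)"
  proof -
    have "((\<lambda>z. z * (pi / 2 - arctan z)) has_real_derivative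
        1 * (pi / 2 - arctan z) + (0 - inverse (1 + z\<^sup>2)) * z) (at z)"
      by (intro DERIV_mult DERIV_diff DERIV_const DERIV_arctan DERIV_ident)
    then show ?thesis by (simp add: arccot_def inverse_eq_divide)
  qed
  with gt show "\<exists>d. ((\<lambda>z. z * arccot z) has_real_derivative d) (at z) \<and> 0 < d" by blast
qed

lemma side_curvature_pos: "0 < x \<Longrightarrow> 0 < side_curvature x y \<theta>"
  using arccot_bounds(1) by (simp add: side_curvature_def add_pos_nonneg)

lemma side_curvature_antimono:
  assumes "0 < x" "0 < \<theta>" "\<theta> \<le> pi / 2" "y \<le> y'"
  shows "side_curvature x y' \<theta> \<le> side_curvature x y \<theta>"
proof -
  have "0 < sin \<theta>" using assms pi_gt_zero by (intro sin_gt_zero) auto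
  then show ?thesis
    unfolding side_curvature_def using assms
    by (intro mult_left_mono arccot_antimono divide_right_mono) auto
qed

text \<open>The common factor \<open>t\<close> cancels in the ratio \<open>y / x\<close>, so that the side contribution becomes a
  function of \<open>sin (arctan (t * x))\<close> alone.\<close>

lemma side_curvature_scale:
  assumes "0 < x" "0 < y" "0 < \<theta>" "\<theta> \<le> pi / 2" "1 < t"
  shows "side_curvature x y \<theta> < side_curvature (t * x) (t * y) \<theta>"
proof -
  define C where "C = (y / x + cos \<theta>) / sin \<theta>"
  have "0 < sin \<theta>" using assms pi_gt_zero by (intro sin_gt_zero) auto
  moreover have "0 \<le> cos \<theta>" using assms by (intro cos_ge_zero) auto
  ultimately have C: "0 < C" unfolding C_def using assms by (simp add: add_pos_nonneg)
  \<comment> \<open>The factor \<open>C\<close> brings the contribution into the form \<open>w * arccot w\<close>.\<close>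
  have eq: "C * side_curvature (s * x) (s * y) \<theta> =
      2 * ((C * sin (arctan (s * x))) * arccot (C * sin (arctan (s * x))))" if "0 < s" for s
  proof -
    have "y = y / x * x" using assms by simp
    then have "s * y + s * x * cos \<theta> = (y / x + cos \<theta>) * (s * x)"
      by (metis distrib_right mult.commute mult.left_commute)
    then have "1 / sin \<theta> * ((s * y + s * x * cos \<theta>) / sqrt (1 + (s * x)\<^sup>2)) = C * sin (arctan (s * x))"
      by (simp add: C_def sin_arctan)
    then show ?thesis by (simp add: side_curvature_def sin_arctan)
  qed
  have "x < t * x" using assms by simp
  then have "sin (arctan x) < sin (arctan (t * x))"
    using arctan_bounded[of "t * x"] arctan_bounded[of x] less_imp_le
    by (intro sin_monotone_2pi) (auto simp: arctan_less_iff)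
  moreover have "0 < sin (arctan x)"
    using assms by (simp add: sin_arctan add_pos_nonneg)
  ultimately have "C * side_curvature x y \<theta> < C * side_curvature (t * x) (t * y) \<theta>"
    using eq[of 1] eq[of t] mult_arccot_strict_mono[of "C * sin (arctan x)" "C * sin (arctan (t * x))"]
      C assms by simp
  then show ?thesis using C by simp
qed

lemma tendsto_side_curvature:
  assumes "(a \<longlongrightarrow> x) G" "(b \<longlongrightarrow> y) G"
  shows "((\<lambda>m. side_curvature (a m) (b m) \<theta>) \<longlongrightarrow> side_curvature x y \<theta>) G"
proof -
  have "sqrt (1 + x\<^sup>2) \<noteq> 0"
    using add_pos_nonneg[of 1 "x\<^sup>2"] by simp
  then show ?thesis
    unfolding side_curvature_def arccot_def by (intro tendsto_intros assms)
qed

section \<open>Sums over the sides of a face\<close>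

text \<open>Finiteness is part of the notion because a sum over an infinite set is 0 by convention: an edge
  with infinitely many bordering faces would contribute nothing to \<open>sum_over_sides\<close>.\<close>

definition has_side :: "'a::t2_space set \<Rightarrow> 'a set \<Rightarrow> 'a set set \<Rightarrow> 'a set \<Rightarrow> bool" where
  "has_side S V E f \<longleftrightarrow> (\<exists>e\<in>edges_of S V E {f}. finite (bordering_faces S V E e))"

text \<open>For a pattern the sum in question is the cone angle. Its positivity thus provides each face with
  a side, which makes total curvatures strictly monotone, and bounds the number of faces.\<close>

lemma has_side_if_sum_over_sides_nonzero:
  assumes "sum_over_sides S V E f h \<noteq> 0"
  shows "has_side S V E f"
proof -
  obtain e where e: "e \<in> edges_of S V E {f}" and
    n: "(if bordering_faces S V E e = {f} then 2 * h f e
        else (\<Sum>g\<in>bordering_faces S V E e - {f}. h g e)) \<noteq> 0"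
    using assms unfolding sum_over_sides_def by (rule sum.not_neutral_contains_not_neutral)
  have "finite (bordering_faces S V E e)"
  proof (rule ccontr)
    assume inf: "infinite (bordering_faces S V E e)"
    then have "infinite (bordering_faces S V E e - {f})" by simp
    with inf n show False by (auto split: if_splits)
  qed
  with e show ?thesis unfolding has_side_def by blast
qed

lemma finite_faces_if_has_side:
  assumes "finite E" "\<And>f. f \<in> faces S V E \<Longrightarrow> has_side S V E f"
  shows "finite (faces S V E)"
proof (rule finite_subset)
  let ?E = "{e \<in> E. finite (bordering_faces S V E e)}"
  show "faces S V E \<subseteq> (\<Union>e\<in>?E. bordering_faces S V E e)"
    using assms(2) by (fastforce simp: has_side_def edges_of_def)
  show "finite (\<Union>e\<in>?E. bordering_faces S V E e)"
    using assms(1) by auto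
qed

lemma sum_over_sides_mono:
  assumes "\<And>g e. g \<in> faces S V E \<Longrightarrow> e \<in> E \<Longrightarrow> h g e \<le> h' g e" "f \<in> faces S V E"
  shows "sum_over_sides S V E f h \<le> sum_over_sides S V E f h'"
  unfolding sum_over_sides_def
  by (intro sum_mono) (use assms in \<open>auto intro!: sum_mono simp: edges_of_def bordering_faces_def\<close>)

lemma sum_over_sides_strict_mono:
  assumes "finite E" "has_side S V E f" "f \<in> faces S V E"
    and less: "\<And>g e. g \<in> faces S V E \<Longrightarrow> e \<in> E \<Longrightarrow> h g e < h' g e"
  shows "sum_over_sides S V E f h < sum_over_sides S V E f h'"
proof -
  let ?B = "bordering_faces S V E"
  let ?s = "\<lambda>h e. if ?B e = {f} then 2 * h f e else (\<Sum>g\<in>?B e - {f}. h g e)"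
  have B: "?B e \<subseteq> faces S V E" for e by (auto simp: bordering_faces_def)
  have le: "h g e \<le> h' g e" if "g \<in> faces S V E" "e \<in> E" for g e
    using less[OF that] by simp
  obtain e where e: "e \<in> E" "f \<in> ?B e" "finite (?B e)"
    using assms(2) by (auto simp: has_side_def edges_of_def)
  have "?s h e < ?s h' e"
  proof (cases "?B e = {f}")
    case True
    with less e assms(3) show ?thesis by simp
  next
    case False
    with e have "?B e - {f} \<noteq> {}" by blast
    then have "(\<Sum>g\<in>?B e - {f}. h g e) < (\<Sum>g\<in>?B e - {f}. h' g e)"
      using e B less by (intro sum_strict_mono) auto
    with False show ?thesis by simp
  qed
  moreover have "?s h e' \<le> ?s h' e'" if "e' \<in> E" for e'
  proof (cases "?B e' = {f}")
    case True
    with le that assms(3) show ?thesis by simp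
  next
    case False
    have "(\<Sum>g\<in>?B e' - {f}. h g e') \<le> (\<Sum>g\<in>?B e' - {f}. h' g e')"
      using B le that by (intro sum_mono) auto
    with False show ?thesis by simp
  qed
  ultimately show ?thesis
    unfolding sum_over_sides_def using e assms(1)
    by (intro sum_strict_mono_ex1 bexI[of _ e]) (simp_all add: edges_of_def)
qed

lemma tendsto_sum_over_sides:
  assumes "\<And>g e. g \<in> faces S V E \<Longrightarrow> e \<in> E \<Longrightarrow> ((\<lambda>m. h m g e) \<longlongrightarrow> l g e) G" "f \<in> faces S V E"
  shows "((\<lambda>m. sum_over_sides S V E f (h m)) \<longlongrightarrow> sum_over_sides S V E f l) G"
  unfolding sum_over_sides_def
proof (rule tendsto_sum)
  fix e assume e: "e \<in> edges_of S V E {f}"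
  show "((\<lambda>m. if bordering_faces S V E e = {f} then 2 * h m f e
        else (\<Sum>g\<in>bordering_faces S V E e - {f}. h m g e)) \<longlongrightarrow>
      (if bordering_faces S V E e = {f} then 2 * l f e
        else (\<Sum>g\<in>bordering_faces S V E e - {f}. l g e))) G"
    using e assms by (auto intro!: tendsto_intros simp: edges_of_def bordering_faces_def)
qed

section \<open>Competitive systems that increase under scaling\<close>

text \<open>These are the properties of total curvatures, as functions of the curvatures, that the convergence
  proof uses. An increase of \<open>k g\<close> can only lower \<open>T k f\<close> for \<open>f \<noteq> g\<close>, but a proportional increase of
  all components raises every \<open>T k f\<close>. Antitonicity, applied in both directions, also says that for
  positive \<open>k\<close> the value \<open>T k f\<close> is determined by \<open>k\<close> on \<open>F\<close>. Accordingly, continuity is expressed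
  by sequences that converge pointwise on \<open>F\<close>.\<close>

locale competitive_system =
  fixes F :: "'f set" and T :: "('f \<Rightarrow> real) \<Rightarrow> 'f \<Rightarrow> real"
  assumes finite_F: "finite F"
    and antimono: "\<lbrakk>f \<in> F; \<forall>g\<in>F. 0 < k g; \<forall>g\<in>F. k g \<le> l g; k f = l f\<rbrakk> \<Longrightarrow> T l f \<le> T k f"
    and scale: "\<lbrakk>f \<in> F; \<forall>g\<in>F. 0 < k g; 1 < t\<rbrakk> \<Longrightarrow> T k f < T (\<lambda>g. t * k g) f"
    and continuous: "\<lbrakk>f \<in> F; \<forall>g\<in>F. 0 < l g; \<And>m. \<forall>g\<in>F. 0 < a m g;
      \<forall>g\<in>F. (\<lambda>m. a m g) \<longlonglongrightarrow> l g\<rbrakk> \<Longrightarrow> (\<lambda>m. T (a m) f) \<longlonglongrightarrow> T l f"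
begin

text \<open>Raising only the component at \<open>f\<close> by a factor is the same as scaling all components by that
  factor and lowering the other ones back again. The first operation raises \<open>T k f\<close>, and the second
  does not lower it.\<close>

lemma strict_mono_own:
  assumes f: "f \<in> F" and k: "\<forall>g\<in>F. 0 < k g" and x: "0 < x" "x < y"
  shows "T (k(f := x)) f < T (k(f := y)) f"
proof -
  let ?t = "y / x"
  have t: "1 < ?t" using x by simp
  have "T (k(f := x)) f < T (\<lambda>g. ?t * (k(f := x)) g) f"
    using f k x t by (intro scale) auto
  also have "\<dots> \<le> T (k(f := y)) f"
  proof (rule antimono[OF f])
    show "\<forall>g\<in>F. 0 < (k(f := y)) g" using k x by auto
    have "1 * k g \<le> ?t * k g" if "g \<in> F" for g
      using k t that by (intro mult_right_mono) (auto simp: less_imp_le)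
    then show "\<forall>g\<in>F. (k(f := y)) g \<le> ?t * (k(f := x)) g" using x by auto
  qed (use x in simp)
  finally show ?thesis .
qed

text \<open>A maximum principle for the ratio \<open>k g / l g\<close>: where it is largest, and above 1, \<open>T k\<close> exceeds \<open>T l\<close>.\<close>

theorem comparison:
  assumes k: "\<forall>g\<in>F. 0 < k g" and l: "\<forall>g\<in>F. 0 < l g" and le: "\<forall>g\<in>F. T k g \<le> T l g"
  shows "\<forall>g\<in>F. k g \<le> l g"
proof (rule ccontr)
  assume "\<not> ?thesis"
  then obtain g where g: "g \<in> F" "l g < k g" by force
  define t where "t = Max ((\<lambda>g. k g / l g) ` F)"
  have "t \<in> (\<lambda>g. k g / l g) ` F"
    unfolding t_def using finite_F g by (intro Max_in) auto
  then obtain f where f: "f \<in> F" "t = k f / l f" by blast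
  have ub: "k h / l h \<le> t" if "h \<in> F" for h
    unfolding t_def using finite_F that by simp
  have "1 < k g / l g" using g l by simp
  with ub[OF g(1)] have t: "1 < t" by simp
  have "T l f < T (\<lambda>g. t * l g) f" using f l t by (intro scale) auto
  also have "\<dots> \<le> T k f"
  proof (rule antimono[OF f(1) k])
    show "\<forall>g\<in>F. k g \<le> t * l g"
      using ub l by (auto simp: pos_divide_le_eq)
    have "l f \<noteq> 0" using l f by force
    then show "k f = t * l f" using f by simp
  qed
  finally show False using le f by force
qed

end

text \<open>The prescribed values are those of a given positive vector \<open>khat\<close>. Besides being the limit, it
  supplies barriers: all its multiples by factors above 1 have larger values of \<open>T\<close>, all multiples by
  factors below 1 smaller ones.\<close>

locale competitive_system_target = competitive_system +
  fixes khat :: "'f \<Rightarrow> real"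
  assumes khat_pos: "\<forall>g\<in>F. 0 < khat g"
begin

definition adjust :: "('f \<Rightarrow> real) \<Rightarrow> 'f \<Rightarrow> real" where
  "adjust k f = (THE x. 0 < x \<and> T (k(f := x)) f = T khat f)"

text \<open>The sum over \<open>F\<close> is a crude upper bound for all ratios between \<open>k\<close> and \<open>khat\<close>.\<close>

lemma sandwich:
  assumes "\<forall>g\<in>F. 0 < k g"
  obtains t where "1 < t" "\<forall>g\<in>F. khat g / t \<le> k g" "\<forall>g\<in>F. k g \<le> t * khat g"
proof
  let ?r = "\<lambda>g. k g / khat g + khat g / k g"
  define t where "t = 2 + (\<Sum>g\<in>F. ?r g)"
  have r: "0 < k g / khat g" "0 < khat g / k g" if "g \<in> F" for g
    using assms khat_pos that by auto
  have le: "?r g \<le> (\<Sum>g\<in>F. ?r g)" if "g \<in> F" for g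
    using finite_F that r by (intro member_le_sum) (auto intro: add_nonneg_nonneg less_imp_le)
  have "0 \<le> (\<Sum>g\<in>F. ?r g)"
    using r by (intro sum_nonneg add_nonneg_nonneg) (auto intro: less_imp_le)
  then show t: "1 < t" unfolding t_def by simp
  have tr: "k g / khat g \<le> t" "khat g / k g \<le> t" if "g \<in> F" for g
    using le[OF that] r[OF that] unfolding t_def by linarith+
  show "\<forall>g\<in>F. khat g / t \<le> k g"
    using tr(2) assms t by (auto simp: pos_divide_le_eq mult.commute)
  show "\<forall>g\<in>F. k g \<le> t * khat g"
    using tr(1) khat_pos by (auto simp: pos_divide_le_eq)
qed

lemma T_scaled_target:
  assumes "f \<in> F" "1 < t"
  shows "T khat f \<le> T (\<lambda>g. t * khat g) f" "T (\<lambda>g. khat g / t) f \<le> T khat f"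
  using scale[OF assms(1) khat_pos assms(2)] scale[OF assms(1) _ assms(2), of "\<lambda>g. khat g / t"]
    khat_pos assms(2) by auto

lemma continuous_own:
  assumes f: "f \<in> F" and k: "\<forall>g\<in>F. 0 < k g" and "0 < a"
  shows "continuous_on {a..b} (\<lambda>x. T (k(f := x)) f)"
  unfolding continuous_on_sequentially comp_def
proof (intro allI ballI impI)
  fix s x assume x: "x \<in> {a..b}" and s: "(\<forall>n. s n \<in> {a..b}) \<and> s \<longlonglongrightarrow> x"
  have sa: "0 < s n" for n using s \<open>0 < a\<close> by (meson atLeastAtMost_iff less_le_trans)
  show "(\<lambda>n. T (k(f := s n)) f) \<longlonglongrightarrow> T (k(f := x)) f"
    by (rule continuous) (use f k x s sa \<open>0 < a\<close> in auto)
qed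

text \<open>By the intermediate value theorem between \<open>khat f / t\<close> and \<open>t * khat f\<close>. At these end points \<open>T\<close> is
  compared with its value at \<open>khat / t\<close> and \<open>t * khat\<close>, which agree with the modified vector at \<open>f\<close>
  and bound it from below and above elsewhere.\<close>

lemma adjust_exists:
  assumes f: "f \<in> F" and k: "\<forall>g\<in>F. 0 < k g"
  shows "\<exists>x>0. T (k(f := x)) f = T khat f"
proof -
  obtain t where t: "1 < t" and lo: "\<forall>g\<in>F. khat g / t \<le> k g" and hi: "\<forall>g\<in>F. k g \<le> t * khat g"
    using sandwich[OF k] .
  let ?a = "khat f / t" and ?b = "t * khat f"
  have a: "0 < ?a" using t khat_pos f by simp
  have "?a \<le> k f" "k f \<le> ?b" using lo hi f by auto
  then have ab: "?a \<le> ?b" by linarith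
  have "T (k(f := ?a)) f \<le> T (\<lambda>g. khat g / t) f"
    by (rule antimono[OF f]) (use t khat_pos lo in auto)
  then have 1: "T (k(f := ?a)) f \<le> T khat f"
    using T_scaled_target(2)[OF f t] by simp
  have "T (\<lambda>g. t * khat g) f \<le> T (k(f := ?b)) f"
    by (rule antimono[OF f]) (use t khat_pos hi k f in auto)
  then have 2: "T khat f \<le> T (k(f := ?b)) f"
    using T_scaled_target(1)[OF f t] by simp
  obtain x where "?a \<le> x" "T (k(f := x)) f = T khat f"
    using IVT'[OF 1 2 ab continuous_own[OF f k a]] by blast
  with a show ?thesis by (intro exI[of _ x]) simp
qed

lemma adjust:
  assumes f: "f \<in> F" and k: "\<forall>g\<in>F. 0 < k g"
  shows "0 < adjust k f" "T (k(f := adjust k f)) f = T khat f"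
proof -
  have "\<exists>!x. 0 < x \<and> T (k(f := x)) f = T khat f"
    using adjust_exists[OF f k] strict_mono_own[OF f k] by (metis less_irrefl linorder_neqE_linordered_idom)
  from theI'[OF this] show "0 < adjust k f" "T (k(f := adjust k f)) f = T khat f"
    unfolding adjust_def by auto
qed

lemma le_adjust_iff:
  assumes "f \<in> F" "\<forall>g\<in>F. 0 < k g" "0 < x"
  shows "x \<le> adjust k f \<longleftrightarrow> T (k(f := x)) f \<le> T khat f"
  using strict_mono_own[OF assms(1,2)] adjust[OF assms(1,2)] assms(3)
  by (metis linorder_not_less order_less_le)

lemma adjust_le_iff:
  assumes "f \<in> F" "\<forall>g\<in>F. 0 < k g" "0 < x"
  shows "adjust k f \<le> x \<longleftrightarrow> T khat f \<le> T (k(f := x)) f"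
  using strict_mono_own[OF assms(1,2)] adjust[OF assms(1,2)] assms(3)
  by (metis linorder_not_less order_less_le)

text \<open>Larger neighbours lower \<open>T\<close> at \<open>f\<close>, and the component at \<open>f\<close> has to grow to make up for it.\<close>

lemma adjust_mono:
  assumes f: "f \<in> F" and k: "\<forall>g\<in>F. 0 < k g" and kl: "\<forall>g\<in>F. k g \<le> l g"
  shows "adjust k f \<le> adjust l f"
proof -
  have l: "\<forall>g\<in>F. 0 < l g" using k kl by force
  have "T (l(f := adjust k f)) f \<le> T (k(f := adjust k f)) f"
    by (rule antimono[OF f]) (use k kl adjust(1)[OF f k] in auto)
  then show ?thesis
    using le_adjust_iff[OF f l adjust(1)[OF f k]] adjust(2)[OF f k] by simp
qed

text \<open>The recursion is imposed on \<open>F\<close> only, so that values elsewhere are free.\<close>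

definition run :: "(nat \<Rightarrow> 'f \<Rightarrow> real) \<Rightarrow> bool" where
  "run k \<longleftrightarrow> (\<forall>g\<in>F. 0 < k 0 g) \<and> (\<forall>m. \<forall>g\<in>F. k (Suc m) g = adjust (k m) g)"

lemma run_pos: "run k \<Longrightarrow> \<forall>g\<in>F. 0 < k m g"
  by (induction m) (auto simp: run_def adjust(1))

lemma run_funpow: "\<forall>g\<in>F. 0 < k g \<Longrightarrow> run (\<lambda>m. (adjust ^^ m) k)"
  by (simp add: run_def)

lemma run_mono:
  assumes "run k" "run l" "\<forall>g\<in>F. k 0 g \<le> l 0 g"
  shows "\<forall>g\<in>F. k m g \<le> l m g"
proof (induction m)
  case (Suc m)
  then show ?case
    using assms adjust_mono[OF _ run_pos[OF assms(1)]] by (auto simp: run_def)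
qed (use assms in simp)

text \<open>If all values of \<open>T\<close> are too small, every component is raised. Raising the component at \<open>f\<close> alone
  would make the value at \<open>f\<close> exact; raising the others as well pushes it below again.\<close>

lemma run_subsolution:
  assumes r: "run k" and T0: "\<forall>f\<in>F. T (k 0) f \<le> T khat f"
  shows "\<forall>f\<in>F. T (k m) f \<le> T khat f" "\<forall>f\<in>F. k m f \<le> k (Suc m) f"
proof -
  have up: "\<forall>f\<in>F. k m f \<le> k (Suc m) f" if "\<forall>f\<in>F. T (k m) f \<le> T khat f" for m
    using that le_adjust_iff[OF _ run_pos[OF r]] run_pos[OF r] r by (simp add: run_def)
  show T: "\<forall>f\<in>F. T (k m) f \<le> T khat f"
  proof (induction m)
    case (Suc m)
    show ?case
    proof
      fix f assume f: "f \<in> F"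
      have "T (k (Suc m)) f \<le> T ((k m)(f := adjust (k m) f)) f"
        by (rule antimono[OF f])
          (use f up[OF Suc] run_pos[OF r] adjust(1)[OF f run_pos[OF r]] r in \<open>auto simp: run_def\<close>)
      then show "T (k (Suc m)) f \<le> T khat f" using adjust(2)[OF f run_pos[OF r]] by simp
    qed
  qed (use T0 in simp)
  show "\<forall>f\<in>F. k m f \<le> k (Suc m) f" using up[OF T] .
qed

lemma run_supersolution:
  assumes r: "run k" and T0: "\<forall>f\<in>F. T khat f \<le> T (k 0) f"
  shows "\<forall>f\<in>F. T khat f \<le> T (k m) f" "\<forall>f\<in>F. k (Suc m) f \<le> k m f"
proof -
  have down: "\<forall>f\<in>F. k (Suc m) f \<le> k m f" if "\<forall>f\<in>F. T khat f \<le> T (k m) f" for m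
    using that adjust_le_iff[OF _ run_pos[OF r]] run_pos[OF r] r by (simp add: run_def)
  show T: "\<forall>f\<in>F. T khat f \<le> T (k m) f"
  proof (induction m)
    case (Suc m)
    show ?case
    proof
      fix f assume f: "f \<in> F"
      have "T ((k m)(f := adjust (k m) f)) f \<le> T (k (Suc m)) f"
        by (rule antimono[OF f])
          (use f down[OF Suc] run_pos[OF r, of "Suc m"] r in \<open>auto simp: run_def\<close>)
      then show "T khat f \<le> T (k (Suc m)) f" using adjust(2)[OF f run_pos[OF r]] by simp
    qed
  qed (use T0 in simp)
  show "\<forall>f\<in>F. k (Suc m) f \<le> k m f" using down[OF T] .
qed

text \<open>Each step solves the equation at \<open>f\<close> exactly for a mixture of two consecutive iterates. Both have the
  same limit, which therefore solves all equations at once.\<close>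

lemma run_limit_eq_target:
  assumes r: "run k" and lim: "\<forall>g\<in>F. (\<lambda>m. k m g) \<longlonglongrightarrow> l g" and l: "\<forall>g\<in>F. 0 < l g"
  shows "\<forall>g\<in>F. l g = khat g"
proof -
  have "T l f = T khat f" if f: "f \<in> F" for f
  proof -
    have "(\<lambda>m. T ((k m)(f := k (Suc m) f)) f) \<longlonglongrightarrow> T l f"
    proof (rule continuous[OF f l])
      show "\<forall>g\<in>F. 0 < ((k m)(f := k (Suc m) f)) g" for m
        using run_pos[OF r, of m] run_pos[OF r, of "Suc m"] by auto
      have "(\<lambda>m. ((k m)(f := k (Suc m) f)) g) \<longlonglongrightarrow> l g" if "g \<in> F" for g
        using lim[rule_format, OF that] LIMSEQ_Suc[OF lim[rule_format, OF f]] by (cases "g = f") simp_all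
      then show "\<forall>g\<in>F. (\<lambda>m. ((k m)(f := k (Suc m) f)) g) \<longlonglongrightarrow> l g" by blast
    qed
    moreover have "T ((k m)(f := k (Suc m) f)) f = T khat f" for m
      using adjust(2)[OF f run_pos[OF r]] r f by (simp add: run_def)
    ultimately show ?thesis by (simp add: LIMSEQ_const_iff)
  qed
  then show ?thesis
    using comparison[OF l khat_pos] comparison[OF khat_pos l] by (simp add: order_antisym)
qed

text \<open>Comparison with \<open>khat\<close> provides the bound that makes the monotone iterates converge.\<close>

lemma run_subsolution_converges:
  assumes r: "run k" and T0: "\<forall>f\<in>F. T (k 0) f \<le> T khat f"
  shows "\<forall>f\<in>F. incseq (\<lambda>m. k m f) \<and> (\<lambda>m. k m f) \<longlonglongrightarrow> khat f"
proof -
  have inc: "incseq (\<lambda>m. k m f)" if "f \<in> F" for f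
    using run_subsolution(2)[OF r T0] that by (simp add: incseq_Suc_iff)
  have le: "k m f \<le> khat f" if "f \<in> F" for m f
    using comparison[OF run_pos[OF r] khat_pos run_subsolution(1)[OF r T0]] that by blast
  have "\<exists>x. (\<lambda>m. k m f) \<longlonglongrightarrow> x \<and> k 0 f \<le> x" if "f \<in> F" for f
    using incseq_convergent[OF inc[OF that]] le[OF that] by metis
  then obtain l where l: "\<forall>f\<in>F. (\<lambda>m. k m f) \<longlonglongrightarrow> l f \<and> k 0 f \<le> l f" by metis
  then have "\<forall>f\<in>F. l f = khat f"
    using run_pos[OF r, of 0] by (intro run_limit_eq_target[OF r]) force+
  with l inc show ?thesis by metis
qed

lemma run_supersolution_converges:
  assumes r: "run k" and T0: "\<forall>f\<in>F. T khat f \<le> T (k 0) f"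
  shows "\<forall>f\<in>F. decseq (\<lambda>m. k m f) \<and> (\<lambda>m. k m f) \<longlonglongrightarrow> khat f"
proof -
  have dec: "decseq (\<lambda>m. k m f)" if "f \<in> F" for f
    using run_supersolution(2)[OF r T0] that by (simp add: decseq_Suc_iff)
  have le: "khat f \<le> k m f" if "f \<in> F" for m f
    using comparison[OF khat_pos run_pos[OF r] run_supersolution(1)[OF r T0]] that by blast
  have "\<exists>x. (\<lambda>m. k m f) \<longlonglongrightarrow> x \<and> khat f \<le> x" if "f \<in> F" for f
    using decseq_convergent[OF dec[OF that]] le[OF that] LIMSEQ_le_const by metis
  then obtain l where l: "\<forall>f\<in>F. (\<lambda>m. k m f) \<longlonglongrightarrow> l f \<and> khat f \<le> l f" by metis
  then have "\<forall>f\<in>F. l f = khat f"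
    using khat_pos by (intro run_limit_eq_target[OF r]) force+
  with l dec show ?thesis by metis
qed

theorem run_converges:
  assumes r: "run k" and f: "f \<in> F"
  shows "(\<lambda>m. k m f) \<longlonglongrightarrow> khat f"
proof -
  have k: "\<forall>g\<in>F. 0 < k 0 g" using run_pos[OF r] .
  obtain t where t: "1 < t" "\<forall>g\<in>F. khat g / t \<le> k 0 g" "\<forall>g\<in>F. k 0 g \<le> t * khat g"
    using sandwich[OF k] .
  let ?lo = "\<lambda>m. (adjust ^^ m) (\<lambda>g. khat g / t)" and ?hi = "\<lambda>m. (adjust ^^ m) (\<lambda>g. t * khat g)"
  have lo: "run ?lo" and hi: "run ?hi"
    using khat_pos t(1) by (auto intro!: run_funpow)
  have "(\<lambda>m. ?lo m f) \<longlonglongrightarrow> khat f"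
    using run_subsolution_converges[OF lo] T_scaled_target(2) t(1) f by simp
  moreover have "(\<lambda>m. ?hi m f) \<longlonglongrightarrow> khat f"
    using run_supersolution_converges[OF hi] T_scaled_target(1) t(1) f by simp
  moreover have "?lo m f \<le> k m f" "k m f \<le> ?hi m f" for m
    using run_mono[OF lo r] run_mono[OF r hi] t f by auto
  ultimately show ?thesis
    by (intro tendsto_sandwich[of "\<lambda>m. ?lo m f" "\<lambda>m. k m f" sequentially "\<lambda>m. ?hi m f"]) auto
qed

theorem run_T_converges:
  assumes r: "run k" and f: "f \<in> F"
  shows "(\<lambda>m. T (k m) f) \<longlonglongrightarrow> T khat f"
  using run_converges[OF r] by (intro continuous[OF f khat_pos run_pos[OF r]]) auto

end

section \<open>Circle patterns and their curvatures\<close>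

lemma arccot_cot:
  assumes "0 < r" "r < pi"
  shows "arccot (cot r) = r"
proof (rule cos_inj_pi)
  have s: "0 < sin r" using assms by (rule sin_gt_zero)
  have "(cos r)\<^sup>2 = 1 - (sin r)\<^sup>2" by (simp add: sin_squared_eq)
  then have "1 + (cot r)\<^sup>2 = (1 / sin r)\<^sup>2"
    using s by (simp add: cot_def power_divide field_simps)
  then have "sqrt (1 + (cot r)\<^sup>2) = 1 / sin r"
    using s by simp
  then show "cos (arccot (cot r)) = cos r"
    using s by (simp add: cos_arccot cot_def)
qed (use assms arccot_bounds[of "cot r"] in auto)

lemma curvatures_pattern_of_curvatures: "curvatures (pattern_of_curvatures S V E \<Theta> k) = k"
  by (simp add: fun_eq_iff curvatures_def geodesic_curvature_def pattern_of_curvatures_def cot_arccot)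

lemma curvatures_pos:
  assumes "ideal_circle_pattern S V E \<Theta> D" "f \<in> faces S V E"
  shows "0 < curvatures D f"
proof -
  have "0 < radius (D f)" "radius (D f) < pi / 2"
    using assms unfolding ideal_circle_pattern_def by blast+
  then have "0 < cos (radius (D f)) / sin (radius (D f))"
    by (intro divide_pos_pos cos_gt_zero sin_gt_zero) auto
  then show ?thesis by (simp add: curvatures_def geodesic_curvature_def cot_def)
qed

text \<open>A pattern is determined by its curvatures, so that the initial and the target pattern also fall
  under the description by vectors \<open>k\<close>.\<close>

lemma pattern_of_curvatures_curvatures:
  assumes D: "ideal_circle_pattern S V E \<Theta> D" and f: "f \<in> faces S V E"
  shows "pattern_of_curvatures S V E \<Theta> (curvatures D) f = D f"
proof -
  have r: "arccot (curvatures D g) = radius (D g)" if "g \<in> faces S V E" for g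
    using D that unfolding ideal_circle_pattern_def curvatures_def geodesic_curvature_def
    by (intro arccot_cot) auto
  have "sum_over_sides S V E f (\<lambda>g e. central_angle (arccot (curvatures D f)) (arccot (curvatures D g)) (\<Theta> e))
      = sum_over_sides S V E f (\<lambda>g e. central_angle (radius (D f)) (radius (D g)) (\<Theta> e))"
    unfolding sum_over_sides_def
    by (intro sum.cong refl if_cong arg_cong[where f = "(*) 2"])
       (use f r in \<open>auto simp: edges_of_def bordering_faces_def\<close>)
  then show ?thesis
    using D f r by (simp add: pattern_of_curvatures_def ideal_circle_pattern_def)
qed

lemma ideal_circle_pattern_has_side:
  assumes "ideal_circle_pattern S V E \<Theta> D" "f \<in> faces S V E"
  shows "has_side S V E f"
proof (rule has_side_if_sum_over_sides_nonzero)
  show "sum_over_sides S V E f (\<lambda>g e. central_angle (radius (D f)) (radius (D g)) (\<Theta> e)) \<noteq> 0"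
    using assms unfolding ideal_circle_pattern_def by (metis less_irrefl)
qed

locale weighted_graph_with_sides =
  fixes S :: "'a::t2_space set" and V :: "'a set" and E :: "'a set set" and \<Theta> :: "'a set \<Rightarrow> real"
  assumes finite_E: "finite E"
    and weights: "e \<in> E \<Longrightarrow> 0 < \<Theta> e \<and> \<Theta> e \<le> pi / 2"
    and sides: "f \<in> faces S V E \<Longrightarrow> has_side S V E f"
begin

abbreviation "TC k \<equiv> total_curvatures (pattern_of_curvatures S V E \<Theta> k)"

lemma TC_eq:
  assumes "\<forall>g\<in>faces S V E. 0 < k g" "f \<in> faces S V E"
  shows "TC k f = sum_over_sides S V E f (\<lambda>g e. side_curvature (k f) (k g) (\<Theta> e))"
  unfolding side_curvature_def
  by (rule total_curvatures_pattern_of_curvatures) (use assms weights in auto)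

lemma TC_pos:
  assumes "\<forall>g\<in>faces S V E. 0 < k g" "f \<in> faces S V E"
  shows "0 < TC k f"
proof -
  have "sum_over_sides S V E f (\<lambda>_ _. 0) < TC k f"
    unfolding TC_eq[OF assms]
    by (rule sum_over_sides_strict_mono[OF finite_E sides[OF assms(2)] assms(2)])
      (simp add: assms side_curvature_pos)
  then show ?thesis by (simp add: sum_over_sides_def cong: if_cong)
qed

sublocale competitive_system "faces S V E" TC
proof
  show "finite (faces S V E)"
    using finite_E sides by (rule finite_faces_if_has_side)
next
  fix f k l
  assume f: "f \<in> faces S V E" and k: "\<forall>g\<in>faces S V E. 0 < (k g :: real)"
    and le: "\<forall>g\<in>faces S V E. k g \<le> l g" and eq: "k f = l f"
  have l: "\<forall>g\<in>faces S V E. 0 < l g" using k le by (meson less_le_trans)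
  show "TC l f \<le> TC k f"
    unfolding TC_eq[OF k f] TC_eq[OF l f] eq
    by (intro sum_over_sides_mono f side_curvature_antimono) (use f l le weights in blast)+
next
  fix f k t
  assume f: "f \<in> faces S V E" and k: "\<forall>g\<in>faces S V E. 0 < (k g :: real)" and t: "1 < (t :: real)"
  then have tk: "\<forall>g\<in>faces S V E. 0 < t * k g" by simp
  show "TC k f < TC (\<lambda>g. t * k g) f"
    unfolding TC_eq[OF k f] TC_eq[OF tk f]
    by (intro sum_over_sides_strict_mono finite_E sides f side_curvature_scale t)
      (use f k weights in blast)+
next
  fix f l and a :: "nat \<Rightarrow> _"
  assume f: "f \<in> faces S V E" and l: "\<forall>g\<in>faces S V E. 0 < (l g :: real)"
    and a: "\<And>m. \<forall>g\<in>faces S V E. 0 < a m g"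
    and lim: "\<forall>g\<in>faces S V E. (\<lambda>m. a m g) \<longlonglongrightarrow> l g"
  show "(\<lambda>m. TC (a m) f) \<longlonglongrightarrow> TC l f"
    unfolding TC_eq[OF a f] TC_eq[OF l f]
    by (intro tendsto_sum_over_sides f tendsto_side_curvature) (use f lim in blast)+
qed

text \<open>The only point is that the cone angles are positive, which they inherit from the total curvatures.\<close>

lemma ideal_circle_pattern_pattern_of_curvatures:
  assumes k: "\<forall>g\<in>faces S V E. 0 < k g"
  shows "ideal_circle_pattern S V E \<Theta> (pattern_of_curvatures S V E \<Theta> k)"
  unfolding ideal_circle_pattern_def
proof (intro ballI conjI)
  fix f assume f: "f \<in> faces S V E"
  let ?D = "pattern_of_curvatures S V E \<Theta> k"
  show r: "0 < radius (?D f)" "radius (?D f) < pi / 2"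
    using k f arccot_bounds arccot_less_pi_half by (simp_all add: pattern_of_curvatures_def)
  have "0 < k f * sin (radius (?D f)) * cone_angle (?D f)"
    using TC_pos[OF k f] curvatures_pattern_of_curvatures[of S V E \<Theta> k]
    by (simp add: total_curvatures_def total_geodesic_curvature_def boundary_length_def
        curvatures_def fun_eq_iff mult_ac)
  moreover have "0 < k f * sin (radius (?D f))"
    using k f r by (auto intro!: mult_pos_pos sin_gt_zero)
  ultimately show "0 < cone_angle (?D f)" by (rule zero_less_mult_pos)
qed (simp add: pattern_of_curvatures_def)

lemma total_curvatures_eq_TC:
  assumes "ideal_circle_pattern S V E \<Theta> D" "f \<in> faces S V E"
  shows "total_curvatures D f = TC (curvatures D) f"
  using pattern_of_curvatures_curvatures[OF assms] by (simp add: total_curvatures_def)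

end

section \<open>Convergence of the algorithm\<close>

theorem theorem1p3:
  fixes S :: "'a::t2_space set" and \<A> :: "('a set \<times> ('a \<Rightarrow> complex)) set"
    and V :: "'a set" and E :: "'a set set" and \<Theta> :: "'a set \<Rightarrow> real"
    and That :: "'a set \<Rightarrow> real" and Dhat D0 :: "'a set \<Rightarrow> conical_disk"
  assumes surface: "closed_oriented_surface S \<A>"
    and graph: "polyhedral_decomposition S V E"
    and weights: "\<forall>e\<in>E. 0 < \<Theta> e \<and> \<Theta> e \<le> pi / 2"
    and That: "That \<in> admissible_total_curvatures S V E \<Theta>"
    and Dhat: "ideal_circle_pattern S V E \<Theta> Dhat"
    and target: "\<forall>f\<in>faces S V E. total_curvatures Dhat f = That f"
    and D0: "ideal_circle_pattern S V E \<Theta> D0"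
    and T0: "total_curvatures D0 \<in> admissible_total_curvatures S V E \<Theta>"
  shows "let F = faces S V E;
             D = thurston_pattern S V E \<Theta> That D0;
             k = (\<lambda>m. curvatures (D m));
             T = (\<lambda>m. total_curvatures (D m))
         in (\<forall>m. ideal_circle_pattern S V E \<Theta> (D m)) \<and>
            (\<forall>f\<in>F. (\<lambda>m. k m f) \<longlonglongrightarrow> curvatures Dhat f) \<and>
            (\<forall>f\<in>F. (\<lambda>m. T m f) \<longlonglongrightarrow> That f) \<and>
            ((\<forall>f\<in>F. T 0 f \<le> That f) \<longrightarrow>
               (\<forall>f\<in>F. incseq (\<lambda>m. k m f) \<and> (\<lambda>m. k m f) \<longlonglongrightarrow> curvatures Dhat f) \<and>
               (\<forall>m. \<forall>f\<in>F. T m f \<le> That f)) \<and>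
            ((\<forall>f\<in>F. That f \<le> T 0 f) \<longrightarrow>
               (\<forall>f\<in>F. decseq (\<lambda>m. k m f) \<and> (\<lambda>m. k m f) \<longlonglongrightarrow> curvatures Dhat f) \<and>
               (\<forall>m. \<forall>f\<in>F. That f \<le> T m f))"
proof -
  let ?F = "faces S V E"
  define D where "D = thurston_pattern S V E \<Theta> That D0"
  define k where "k m = curvatures (D m)" for m
  interpret weighted_graph_with_sides S V E \<Theta>
    using graph weights ideal_circle_pattern_has_side[OF D0]
    by unfold_locales (auto simp: polyhedral_decomposition_def embedded_graph_def)
  interpret competitive_system_target ?F TC "curvatures Dhat"
    by unfold_locales (simp add: curvatures_pos[OF Dhat])
  have That_eq: "That f = TC (curvatures Dhat) f" if "f \<in> ?F" for f
    using target total_curvatures_eq_TC[OF Dhat that] that by simp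
  have k_Suc: "k (Suc m) = thurston_step S V E \<Theta> That (k m)" for m
    by (simp add: k_def D_def curvatures_pattern_of_curvatures)
  \<comment> \<open>The algorithm refers to \<open>That\<close>, the abstract step to the values at the target; they agree on faces.\<close>
  have run: "run k"
    unfolding run_def
    by (simp add: k_Suc thurston_step_def adjust_def That_eq) (simp add: k_def D_def curvatures_pos[OF D0])
  have pattern: "ideal_circle_pattern S V E \<Theta> (D m)" for m
  proof (cases m)
    case (Suc n)
    have "D m = pattern_of_curvatures S V E \<Theta> (k m)"
      unfolding Suc k_Suc by (simp add: D_def k_def)
    then show ?thesis
      using ideal_circle_pattern_pattern_of_curvatures[OF run_pos[OF run]] by simp
  qed (simp add: D_def D0)
  have T: "total_curvatures (D m) f = TC (k m) f" if "f \<in> ?F" for m f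
    unfolding k_def using total_curvatures_eq_TC[OF pattern that] .
  show ?thesis
    unfolding Let_def D_def[symmetric] k_def[symmetric]
    using pattern run_converges[OF run] run_T_converges[OF run]
      run_subsolution_converges[OF run] run_subsolution(1)[OF run]
      run_supersolution_converges[OF run] run_supersolution(1)[OF run]
    by (simp add: T That_eq)
qed

end
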